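(* For every integer $d \ge 1$ there exists a constant $c_d > 0$ (depending only on $d$) such that $\mathsf{m}_d(A) \ge c_d A^{2d}$ for all real $A > 0$.
   Context: For $x = (x_1,\ldots,x_d) \in \mathbb{R}^d$, write $|x| = \max_i |x_i|$ (the $\ell^\infty$-norm). Let $\varphi_d$ denote the standard Gaussian density on $\mathbb{R}^d$ (zero mean and identity covariance), i.e., $\varphi_d(t) = (2\pi)^{-d/2} e^{-\frac12 (t_1^2 + \cdots + t_d^2)}$. For $A > 0$, $\mathsf{m}_d(A)$ denotes the maximum number of modes (local maxima on $\mathbb{R}^d$) that a Gaussian mixture density $f(t) = p_1 \varphi_d(t-a_1) + \cdots + p_N \varphi_d(t-a_N)$ can have, over all integers $N \ge 1$, all $a_1,\ldots,a_N \in \mathbb{R}^d$ with $|a_k| \le A$ for all $k$, and all $p_1,\ldots,p_N > 0$ summing to $1$. If the maximum is not attained, it is understood as the supremum in $\mathbb{N} \cup \{\infty\}$. *)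

theory Defs
  imports "HOL-Analysis.Analysis"
begin

definition gauss_density :: "real ^ 'n \<Rightarrow> real" where
  "gauss_density t =
     (2 * pi) powr (- (real CARD('n) / 2)) * exp (- (1 / 2) * (\<Sum>i\<in>UNIV. (t $ i)\<^sup>2))"

definition gauss_mixture ::
  "nat \<Rightarrow> (nat \<Rightarrow> real) \<Rightarrow> (nat \<Rightarrow> real ^ 'n) \<Rightarrow> real ^ 'n \<Rightarrow> real" where
  "gauss_mixture N p a t = (\<Sum>k<N. p k * gauss_density (t - a k))"

(* Local maxima are not required to be strict. *)
definition modes :: "('a::topological_space \<Rightarrow> real) \<Rightarrow> 'a set" where
  "modes f = {t. \<forall>\<^sub>F s in nhds t. f s \<le> f t}"

(* card is 0 on infinite sets, hence the case distinction. *)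
definition num_modes :: "('a::topological_space \<Rightarrow> real) \<Rightarrow> enat" where
  "num_modes f = (if finite (modes f) then enat (card (modes f)) else \<infinity>)"

(* The dimension d is CARD('n), passed as a type argument; infnorm is the l-infinity norm,
   as infnorm_cart shows. Only the values of p and a at indices k < N matter. *)
definition max_modes :: "'n::finite itself \<Rightarrow> real \<Rightarrow> enat" where
  "max_modes _ A =
     Sup {num_modes (gauss_mixture N p a) | N p (a :: nat \<Rightarrow> real ^ 'n).
            N \<ge> 1 \<and> (\<forall>k<N. infnorm (a k) \<le> A) \<and> (\<forall>k<N. p k > 0) \<and> (\<Sum>k<N. p k) = 1}"

end

theory Submission
  imports Defs "HOL-Probability.Characteristic_Functions"
begin

text \<open>
  In dimension one, put the weight \<open>2 - cos (\<omega> a)\<close> with \<open>\<omega> = A / 4\<close> on \<open>[-A, A]\<close>. Without truncation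
  its convolution with the Gaussian is \<open>2 - exp (-\<omega>\<^sup>2 / 2) cos (\<omega> t)\<close>, an oscillation of amplitude
  \<open>exp (-A\<^sup>2 / 32)\<close>, whereas for \<open>\<bar>t\<bar> \<le> A / 2\<close> the truncation costs only \<open>O(exp (-A\<^sup>2 / 16))\<close>. Hence the
  values at the \<open>\<asymp> A\<^sup>2\<close> points \<open>j \<pi> / \<omega>\<close> in \<open>[0, A / 2]\<close> alternate. These are finitely many strict
  inequalities, so they survive replacing the integral by a Riemann sum, i.e. by a finite mixture,
  which has a mode between any two consecutive even points. In dimension \<open>d\<close> take the product of
  \<open>d\<close> copies: every \<open>d\<close>-tuple of modes is a mode.
\<close>

section \<open>Modes on the line and the Gaussian convolution of a cosine weight\<close>

lemma mode_between:
  fixes h :: "real \<Rightarrow> real"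
  assumes cont: "continuous_on {a..b} h" and "a < t" "t < b" "h a < h t" "h b < h t"
  shows "\<exists>m\<in>{a<..<b}. m \<in> modes h"
proof -
  have "compact {a..b}" "{a..b} \<noteq> {}" using assms by auto
  from continuous_attains_sup[OF this cont]
  obtain m where m: "m \<in> {a..b}" "\<And>y. y \<in> {a..b} \<Longrightarrow> h y \<le> h m" by blast
  \<comment> \<open>The maximum over \<open>{a..b}\<close> beats both endpoint values, so it is
    interior and hence a local maximum of \<open>h\<close>.\<close>
  have "h t \<le> h m" using m assms by auto
  then have "m \<noteq> a" "m \<noteq> b" using assms by auto
  then have mi: "m \<in> {a<..<b}" using m by auto
  then have "\<forall>\<^sub>F s in nhds m. s \<in> {a<..<b}"
    by (intro eventually_nhds_in_open) auto
  then have "\<forall>\<^sub>F s in nhds m. h s \<le> h m"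
    by eventually_elim (use m in auto)
  with mi show ?thesis unfolding modes_def by blast
qed

text \<open>The integrand is the real part of \<open>iexp (\<omega> * t)\<close> times the integrand
  of the characteristic function of the standard normal; the value of the latter is the damping
  factor.\<close>

lemma integral_cos_std_normal:
  shows "integrable lborel (\<lambda>z. std_normal_density z * cos (\<omega> * (t + z)))"
    and "(LBINT z. std_normal_density z * cos (\<omega> * (t + z))) = exp (- (\<omega>\<^sup>2) / 2) * cos (\<omega> * t)"
proof -
  have int: "integrable lborel (\<lambda>z. std_normal_density z *\<^sub>R iexp (\<omega> * z))"
    by (rule Bochner_Integration.integrable_bound[OF integrable_normal_density[of 1 0]]) auto
  have "(CLBINT z. std_normal_density z *\<^sub>R iexp (\<omega> * z)) = char std_normal_distribution \<omega>"
    unfolding char_def by (subst integral_density) auto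
  then have val: "(CLBINT z. std_normal_density z *\<^sub>R iexp (\<omega> * z)) = complex_of_real (exp (- (\<omega>\<^sup>2) / 2))"
    by (simp add: char_std_normal_distribution)
  let ?f = "\<lambda>z. iexp (\<omega> * t) * (std_normal_density z *\<^sub>R iexp (\<omega> * z))"
  have Re: "Re (?f z) = std_normal_density z * cos (\<omega> * (t + z))" for z
    unfolding cis_conv_exp[symmetric] by (simp add: distrib_left cos_add algebra_simps)
  have int': "integrable lborel ?f" using int by (rule integrable_mult_right)
  from integrable_Re[OF int'] show "integrable lborel (\<lambda>z. std_normal_density z * cos (\<omega> * (t + z)))"
    unfolding Re .
  have "(LBINT z. Re (?f z)) = Re (CLBINT z. ?f z)" using int' by (rule integral_Re)
  also have "(CLBINT z. ?f z) = iexp (\<omega> * t) * complex_of_real (exp (- (\<omega>\<^sup>2) / 2))"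
    by (subst integral_mult_right_zero) (simp only: val)
  also have "Re \<dots> = exp (- (\<omega>\<^sup>2) / 2) * cos (\<omega> * t)"
    by (simp add: Re_exp)
  finally show "(LBINT z. std_normal_density z * cos (\<omega> * (t + z))) = exp (- (\<omega>\<^sup>2) / 2) * cos (\<omega> * t)"
    unfolding Re .
qed

text \<open>The substitution a = t + z turns the cosine part into the previous integral. The
  constant 2 keeps the weight between 1 and 3, so it can later supply positive mixture
  weights.\<close>

lemma cosine_weight_convolution:
  shows "integrable lborel (\<lambda>a. (2 - cos (\<omega> * a)) * std_normal_density (t - a))"
    and "(LBINT a. (2 - cos (\<omega> * a)) * std_normal_density (t - a)) =
           2 - exp (- (\<omega>\<^sup>2) / 2) * cos (\<omega> * t)"
proof -
  let ?g = "\<lambda>a. (2 - cos (\<omega> * a)) * std_normal_density (t - a)"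
  \<comment> \<open>The factor 1 matches the shape of the affine substitution rules for
    \<open>lborel\<close>.\<close>
  have shift: "?g (t + 1 * z) = 2 * std_normal_density z - std_normal_density z * cos (\<omega> * (t + z))" for z
  proof -
    have "std_normal_density (t - (t + 1 * z)) = std_normal_density z"
      by (simp add: normal_density_def)
    then show ?thesis by (simp add: algebra_simps)
  qed
  have "integrable lborel (\<lambda>z. ?g (t + 1 * z))"
    unfolding shift by (intro Bochner_Integration.integrable_diff integral_cos_std_normal) auto
  then show "integrable lborel ?g"
    by (subst (asm) lborel_integrable_real_affine_iff) auto
  have "(LBINT a. ?g a) = (LBINT z. ?g (t + 1 * z))"
    by (subst lborel_integral_real_affine[of 1 _ t]) auto
  also have "\<dots> = 2 - exp (- (\<omega>\<^sup>2) / 2) * cos (\<omega> * t)"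
    unfolding shift
    by (subst Bochner_Integration.integral_diff) (auto simp: integral_cos_std_normal)
  finally show "(LBINT a. ?g a) = 2 - exp (- (\<omega>\<^sup>2) / 2) * cos (\<omega> * t)" .
qed

text \<open>Half of the exponent x^2/2 is traded for r^2/4; what remains is, up to the factor sqrt
  2, the density of variance 2, whose total mass 1 makes the tail integral explicit.\<close>

lemma std_normal_density_tail:
  assumes "\<bar>x\<bar> \<ge> r" "r \<ge> 0"
  shows "std_normal_density x \<le> sqrt 2 * exp (- (r\<^sup>2) / 4) * normal_density 0 (sqrt 2) x"
proof -
  have "r\<^sup>2 \<le> x\<^sup>2" using assms by (metis abs_le_square_iff abs_of_nonneg)
  then have "exp (- (x\<^sup>2) / 2) \<le> exp (- (r\<^sup>2) / 4 - x\<^sup>2 / 4)"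
    by simp
  also have "\<dots> = exp (- (r\<^sup>2) / 4) * exp (- (x\<^sup>2) / 4)"
    by (simp add: exp_add[symmetric])
  finally have "exp (- (x\<^sup>2) / 2) / sqrt (2 * pi) \<le> exp (- (r\<^sup>2) / 4) * exp (- (x\<^sup>2) / 4) / sqrt (2 * pi)"
    by (rule divide_right_mono) simp
  also have "\<dots> = sqrt 2 * exp (- (r\<^sup>2) / 4) * normal_density 0 (sqrt 2) x"
  proof -
    have "sqrt (4 * pi) = sqrt 2 * sqrt (2 * pi)" by (simp flip: real_sqrt_mult)
    then show ?thesis by (simp add: normal_density_def)
  qed
  finally show ?thesis by (simp add: std_normal_density_def)
qed

text \<open>As \<open>g\<close> is nonnegative, truncation only lowers the integral. Points outside
  \<open>{-A..A}\<close> lie at distance at least A/2 from \<open>t\<close>, so the tail bound with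
  r = A/2 and the weight bound 3 control the loss.\<close>

lemma truncated_convolution_bounds:
  fixes A \<omega> t :: real
  defines "g \<equiv> \<lambda>a. (2 - cos (\<omega> * a)) * std_normal_density (t - a)"
  assumes t: "\<bar>t\<bar> \<le> A / 2"
  shows "(g has_integral integral {-A..A} g) {-A..A}"
    and "integral {-A..A} g \<le> 2 - exp (- (\<omega>\<^sup>2) / 2) * cos (\<omega> * t)"
    and "integral {-A..A} g \<ge> 2 - exp (- (\<omega>\<^sup>2) / 2) * cos (\<omega> * t) - 3 * sqrt 2 * exp (- (A\<^sup>2) / 16)"
proof -
  have int: "integrable lborel g" unfolding g_def by (rule cosine_weight_convolution)
  have val: "(LBINT a. g a) = 2 - exp (- (\<omega>\<^sup>2) / 2) * cos (\<omega> * t)"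
    unfolding g_def by (rule cosine_weight_convolution)
  have g0: "g a \<ge> 0" for a
  proof -
    have "2 - cos (\<omega> * a) \<ge> 0" using cos_le_one[of "\<omega> * a"] by linarith
    then show ?thesis unfolding g_def by (intro mult_nonneg_nonneg) auto
  qed
  have si: "set_integrable lborel {-A..A} g"
    unfolding set_integrable_def using int by (intro integrable_mult_indicator) auto
  have eq: "integral {-A..A} g = (LBINT a:{-A..A}. g a)"
    by (rule set_borel_integral_eq_integral(2)[OF si, symmetric])
  show "(g has_integral integral {-A..A} g) {-A..A}"
    using set_borel_integral_eq_integral(1)[OF si] by (rule integrable_integral)
  show "integral {-A..A} g \<le> 2 - exp (- (\<omega>\<^sup>2) / 2) * cos (\<omega> * t)"
    unfolding eq val[symmetric] set_lebesgue_integral_def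
    using si int g0 by (intro integral_mono) (auto simp: set_integrable_def indicator_def)
  let ?n = "\<lambda>a. normal_density 0 (sqrt 2) (t - a)"
  have n_int: "integrable lborel ?n" and n_val: "(LBINT a. ?n a) = 1"
  proof -
    have "?n = normal_density t (sqrt 2)"
      by (auto simp: normal_density_def fun_eq_iff power2_commute)
    then show "integrable lborel ?n" "(LBINT a. ?n a) = 1" by auto
  qed
  let ?C = "3 * sqrt 2 * exp (- (A\<^sup>2) / 16)"
  have tail: "g a \<le> indicator {-A..A} a *\<^sub>R g a + ?C * ?n a" for a
  proof (cases "a \<in> {-A..A}")
    case True
    then show ?thesis by simp
  next
    case False
    then have "\<bar>t - a\<bar> \<ge> A / 2" using t by auto
    moreover have "A / 2 \<ge> 0" using t by auto
    ultimately have "std_normal_density (t - a) \<le> sqrt 2 * exp (- ((A / 2)\<^sup>2) / 4) * ?n a"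
      by (rule std_normal_density_tail)
    moreover have "2 - cos (\<omega> * a) \<le> 3" using cos_ge_minus_one[of "\<omega> * a"] by linarith
    ultimately have "g a \<le> 3 * (sqrt 2 * exp (- ((A / 2)\<^sup>2) / 4) * ?n a)"
      unfolding g_def by (intro mult_mono) auto
    then show ?thesis using False by (simp add: power_divide)
  qed
  have "(LBINT a. g a) \<le> (LBINT a. indicator {-A..A} a *\<^sub>R g a + ?C * ?n a)"
    using si int n_int tail unfolding set_integrable_def
    by (intro integral_mono Bochner_Integration.integrable_add integrable_mult_right) auto
  also have "\<dots> = (LBINT a:{-A..A}. g a) + ?C"
    using si n_int unfolding set_integrable_def set_lebesgue_integral_def
    by (subst Bochner_Integration.integral_add) (auto simp: n_val)
  finally show "integral {-A..A} g \<ge> 2 - exp (- (\<omega>\<^sup>2) / 2) * cos (\<omega> * t) - 3 * sqrt 2 * exp (- (A\<^sup>2) / 16)"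
    unfolding eq val by linarith
qed

section \<open>From integrals to finite mixtures with many modes on the line\<close>

lemma simultaneous_Riemann_sums:
  fixes f :: "'t \<Rightarrow> real \<Rightarrow> real"
  assumes "finite T" and int: "\<And>t. t \<in> T \<Longrightarrow> (f t has_integral F t) {a..b}" and "e > 0"
  obtains D where "D tagged_division_of {a..b}"
    "\<And>t. t \<in> T \<Longrightarrow> \<bar>(\<Sum>(x, K)\<in>D. measure lborel K * f t x) - F t\<bar> < e"
proof -
  have "\<exists>\<gamma>. gauge \<gamma> \<and> (\<forall>D. D tagged_division_of {a..b} \<and> \<gamma> fine D \<longrightarrow>
          \<bar>(\<Sum>(x, K)\<in>D. measure lborel K * f t x) - F t\<bar> < e)" if "t \<in> T" for t
    using int[OF that] \<open>e > 0\<close> unfolding has_integral_real by auto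
  then obtain \<gamma> where \<gamma>: "\<And>t. t \<in> T \<Longrightarrow> gauge (\<gamma> t)"
    "\<And>t D. \<lbrakk>t \<in> T; D tagged_division_of {a..b}; \<gamma> t fine D\<rbrakk> \<Longrightarrow>
       \<bar>(\<Sum>(x, K)\<in>D. measure lborel K * f t x) - F t\<bar> < e"
    by metis
  \<comment> \<open>A finite intersection of gauges is a gauge, so one tagged division serves every
    \<open>t\<close>: the centres and weights of a mixture must not depend on
    \<open>t\<close>.\<close>
  have "gauge (\<lambda>x. \<Inter>{\<gamma> t x |t. t \<in> T})"
    using \<open>finite T\<close> \<gamma>(1) by (rule gauge_Inter)
  then obtain D where D: "D tagged_division_of cbox a b" "(\<lambda>x. \<Inter>{\<gamma> t x |t. t \<in> T}) fine D"
    by (rule fine_division_exists)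
  show ?thesis
    using D by (intro that[of D] \<gamma>(2)) (auto simp: fine_Inter)
qed

text \<open>The index set is arbitrary so that the pairs of a tagged division can index the
  components; normalising the weights is postponed, since positive scaling moves no mode.\<close>

definition finite_mixture :: "'b set \<Rightarrow> ('b \<Rightarrow> real) \<Rightarrow> ('b \<Rightarrow> real) \<Rightarrow> real \<Rightarrow> real" where
  "finite_mixture I w x s = (\<Sum>k\<in>I. w k * std_normal_density (s - x k))"

text \<open>The threshold 10 serves twice: the oscillation outweighs the truncation error, and the
  rounding in \<open>n\<close> is absorbed by the constant 1/128.\<close>

lemma line_mixture_many_modes_large:
  fixes A :: real
  assumes A: "A \<ge> 10"
  obtains I :: "(real \<times> real set) set" and w x M where
    "finite I" "I \<noteq> {}" "\<And>k. k \<in> I \<Longrightarrow> w k > 0" "\<And>k. k \<in> I \<Longrightarrow> \<bar>x k\<bar> \<le> A"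
    "finite M" "M \<subseteq> modes (finite_mixture I w x)" "real (card M) \<ge> A\<^sup>2 / 128"
proof -
  define \<omega> where "\<omega> = A / 4"
  \<comment> \<open>Chosen so that \<open>y (2 * n)\<close> stays at most A/2.\<close>
  define n where "n = nat \<lfloor>A\<^sup>2 / (16 * pi)\<rfloor>"
  define y where "y = (\<lambda>j::nat. real j * pi / \<omega>)"
  define f where "f = (\<lambda>t a. (2 - cos (\<omega> * a)) * std_normal_density (t - a))"
  define F where "F = (\<lambda>t. integral {-A..A} (f t))"
  have \<omega>: "\<omega> > 0" using A by (simp add: \<omega>_def)
  have A2: "A\<^sup>2 \<ge> 100" using power_mono[of 10 A 2] A by simp
  have "real n = of_int \<lfloor>A\<^sup>2 / (16 * pi)\<rfloor>" unfolding n_def by simp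
  then have n: "real n \<le> A\<^sup>2 / (16 * pi)" "real n > A\<^sup>2 / (16 * pi) - 1" by linarith+
  have y_mono: "y i < y j \<longleftrightarrow> i < j" "y i \<le> y j \<longleftrightarrow> i \<le> j" for i j
    using \<omega> by (auto simp: y_def field_simps)
  have y_small: "\<bar>y j\<bar> \<le> A / 2" if "j \<le> 2 * n" for j
  proof -
    have "real j \<le> 2 * real n" using that by linarith
    also have "\<dots> \<le> A\<^sup>2 / (8 * pi)" using n by simp
    finally have "real j * pi \<le> A\<^sup>2 / 8" by (simp add: field_simps)
    then have "real j * pi / \<omega> \<le> (A\<^sup>2 / 8) / \<omega>" using \<omega> by (intro divide_right_mono) auto
    also have "\<dots> = A / 2" using A by (simp add: \<omega>_def power2_eq_square field_simps)
    finally show ?thesis using \<omega> by (simp add: y_def)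
  qed
  have cos_y: "cos (\<omega> * y j) = (-1) ^ j" for j
    using \<omega> by (simp add: y_def cos_npi)
  \<comment> \<open>\<open>2 * e\<close> bounds from below the gap between \<open>F\<close> at odd
    and at even points, so Riemann sums with error below \<open>e\<close> still alternate
    strictly.\<close>
  define e where "e = exp (- (\<omega>\<^sup>2) / 2) - 3 * sqrt 2 / 2 * exp (- (A\<^sup>2) / 16)"
  have e: "e > 0"
  proof -
    \<comment> \<open>Since \<omega>^2/2 = A^2/32, the claim amounts to 3 sqrt 2 / 2 < exp
      (A^2/32).\<close>
    have "3 * sqrt 2 / 2 < (3::real)" using real_sqrt_less_mono[of 2 4] by simp
    also have "(3::real) \<le> 1 + A\<^sup>2 / 32" using A2 by simp
    also have "\<dots> \<le> exp (A\<^sup>2 / 32)" by (rule exp_ge_add_one_self)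
    finally have "3 * sqrt 2 / 2 * exp (- (A\<^sup>2) / 16) < exp (A\<^sup>2 / 32) * exp (- (A\<^sup>2) / 16)"
      by (rule mult_strict_right_mono) simp
    also have "\<dots> = exp (- (\<omega>\<^sup>2) / 2)"
      by (simp add: \<omega>_def power_divide exp_add[symmetric])
    finally show ?thesis by (simp add: e_def)
  qed
  have F_even: "F (y j) \<le> 2 - exp (- (\<omega>\<^sup>2) / 2)" if "j \<le> 2 * n" "even j" for j
    using truncated_convolution_bounds(2)[OF y_small[OF that(1)], of \<omega>] that
    unfolding F_def f_def by (simp add: cos_y)
  have F_odd: "F (y j) \<ge> 2 - exp (- (\<omega>\<^sup>2) / 2) + 2 * e" if "j \<le> 2 * n" "odd j" for j
    using truncated_convolution_bounds(3)[OF y_small[OF that(1)], of \<omega>] that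
    unfolding F_def f_def e_def by (simp add: cos_y)
  have F_int: "(f t has_integral F t) {-A..A}" if "t \<in> y ` {..2 * n}" for t
    unfolding F_def f_def
    by (rule truncated_convolution_bounds(1)) (use that y_small in auto)
  have "finite (y ` {..2 * n})" by simp
  from simultaneous_Riemann_sums[where f = f and F = F, OF this F_int e]
  obtain D where D: "D tagged_division_of {-A..A}"
    and approx: "\<And>t. t \<in> y ` {..2 * n} \<Longrightarrow> \<bar>(\<Sum>(x, K)\<in>D. measure lborel K * f t x) - F t\<bar> < e"
    by blast
  \<comment> \<open>Degenerate intervals contribute nothing to the sum; dropping them makes all
    weights strictly positive.\<close>
  define I where "I = {k \<in> D. measure lborel (snd k) > 0}"
  define w where "w = (\<lambda>k::real \<times> real set. measure lborel (snd k) * (2 - cos (\<omega> * fst k)))"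
  define h where "h = finite_mixture I w fst"
  have "finite D" using D by (rule tagged_division_of_finite)
  then have finI: "finite I" by (simp add: I_def)
  have h_eq: "h t = (\<Sum>(x, K)\<in>D. measure lborel K * f t x)" for t
    unfolding h_def finite_mixture_def
    by (rule sum.mono_neutral_cong_left)
       (use \<open>finite D\<close> in \<open>auto simp: I_def w_def f_def content_pos_lt_eq less_le\<close>)
  have "2 - cos u > (0::real)" for u using cos_le_one[of u] by linarith
  then have wpos: "w k > 0" if "k \<in> I" for k
    using that by (auto simp: I_def w_def intro!: mult_pos_pos)
  have xA: "\<bar>fst k\<bar> \<le> A" if "k \<in> I" for k
    using tag_in_interval[OF D, of "fst k" "snd k"] that by (auto simp: I_def)
  have h_even: "h (y j) < 2 - exp (- (\<omega>\<^sup>2) / 2) + e" if "j \<le> 2 * n" "even j" for j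
    using approx[of "y j"] F_even[OF that] that unfolding h_eq by (auto simp: abs_less_iff)
  have h_odd: "h (y j) > 2 - exp (- (\<omega>\<^sup>2) / 2) + e" if "j \<le> 2 * n" "odd j" for j
    using approx[of "y j"] F_odd[OF that] that unfolding h_eq by (auto simp: abs_less_iff)
  have cont: "continuous_on S h" for S
    unfolding h_def finite_mixture_def[abs_def] normal_density_def
    by (intro continuous_intros) auto
  have "\<exists>m\<in>{y (2 * j)<..<y (2 * j + 2)}. m \<in> modes h" if "j < n" for j
    by (rule mode_between[OF cont, of _ "y (2 * j + 1)"])
       (use that h_even[of "2 * j"] h_even[of "2 * j + 2"] h_odd[of "2 * j + 1"] in \<open>auto simp: y_mono\<close>)
  then obtain m where m: "\<And>j. j < n \<Longrightarrow> m j \<in> {y (2 * j)<..<y (2 * j + 2)}" 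
    "\<And>j. j < n \<Longrightarrow> m j \<in> modes h"
    by metis
  have m_less: "m i < m j" if "i < j" "j < n" for i j
  proof -
    have "m i < y (2 * i + 2)" using m(1)[of i] that by auto
    also have "\<dots> \<le> y (2 * j)" using that by (simp add: y_mono)
    also have "\<dots> < m j" using m(1)[of j] that by auto
    finally show ?thesis .
  qed
  have "inj_on m {..<n}"
    by (rule linorder_inj_onI) (use m_less in \<open>force+\<close>)
  then have "card (m ` {..<n}) = n" by (simp add: card_image)
  moreover have "real n \<ge> A\<^sup>2 / 128"
  proof -
    \<comment> \<open>With pi at most 16/5, \<open>n\<close> exceeds 5/256 A^2 - 1, and 3/256 A^2 is
      at least 1 because A^2 is at least 100.\<close>
    have "16 * pi \<le> 16 * (16/5)" using pi_approx by simp
    then have "A\<^sup>2 / (16 * (16/5)) \<le> A\<^sup>2 / (16 * pi)"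
      using A2 by (intro divide_left_mono) auto
    then have "5 / 256 * A\<^sup>2 \<le> A\<^sup>2 / (16 * pi)" by simp
    then show ?thesis using n(2) A2 by linarith
  qed
  moreover have "I \<noteq> {}"
  proof
    assume "I = {}"
    \<comment> \<open>The zero function cannot lie on both sides of the threshold separating
      \<open>y 0\<close> from \<open>y 1\<close>.\<close>
    then have "h s = 0" for s by (simp add: h_def finite_mixture_def)
    moreover have "n \<ge> 1" using \<open>real n \<ge> A\<^sup>2 / 128\<close> A2 by (cases n) auto
    ultimately show False using h_even[of 0] h_odd[of 1] by auto
  qed
  ultimately show ?thesis
    using m(2) finI wpos xA by (intro that[of I w fst "m ` {..<n}"]) (auto simp: h_def)
qed

lemma line_mixture_many_modes:
  fixes A :: real
  assumes A: "A > 0"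
  obtains I :: "(real \<times> real set) set" and w x M where
    "finite I" "I \<noteq> {}" "\<And>k. k \<in> I \<Longrightarrow> w k > 0" "\<And>k. k \<in> I \<Longrightarrow> \<bar>x k\<bar> \<le> A"
    "finite M" "M \<subseteq> modes (finite_mixture I w x)" "real (card M) \<ge> A\<^sup>2 / 128"
proof (cases "A \<ge> 10")
  case True
  then obtain I :: "(real \<times> real set) set" and w x M where *:
    "finite I" "I \<noteq> {}" "\<And>k. k \<in> I \<Longrightarrow> w k > 0" "\<And>k. k \<in> I \<Longrightarrow> \<bar>x k\<bar> \<le> A"
    "finite M" "M \<subseteq> modes (finite_mixture I w x)" "real (card M) \<ge> A\<^sup>2 / 128"
    by (rule line_mixture_many_modes_large) blast
  then show ?thesis by (intro that[of I w x M])
next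
  case False
  \<comment> \<open>Here A^2/128 is below 1, so a single centred Gaussian with its mode at 0
    suffices; its index is a dummy.\<close>
  have "A\<^sup>2 \<le> 10\<^sup>2" using False A by (intro power_mono) auto
  moreover have "0 \<in> modes (finite_mixture {(0::real, {}::real set)} (\<lambda>_. 1) (\<lambda>_. 0))"
    by (auto simp: modes_def finite_mixture_def normal_density_def divide_right_mono)
  ultimately show ?thesis
    using A by (intro that[of "{(0::real, {}::real set)}" "\<lambda>_. 1" "\<lambda>_. 0" "{0}"]) auto
qed

section \<open>Products of line mixtures in dimension \<open>CARD('n)\<close>\<close>

lemma gauss_density_eq_prod:
  fixes t :: "real ^ 'n::finite"
  shows "gauss_density t = (\<Prod>i\<in>UNIV. std_normal_density (t $ i))"
proof -
  have "(\<Prod>i\<in>(UNIV::'n set). std_normal_density (t $ i)) =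
      (1 / sqrt (2 * pi)) ^ CARD('n) * exp (\<Sum>i\<in>UNIV. - (t $ i)\<^sup>2 / 2)"
    unfolding std_normal_density_def prod.distrib by (simp add: exp_sum)
  also have "(\<Sum>i\<in>UNIV. - (t $ i)\<^sup>2 / 2) = - (1 / 2) * (\<Sum>i\<in>UNIV. (t $ i)\<^sup>2)"
    by (simp add: sum_negf sum_divide_distrib)
  also have "(1 / sqrt (2 * pi)) ^ CARD('n) = (2 * pi) powr (- (real CARD('n) / 2))"
  proof -
    have "(1 / sqrt (2 * pi)) ^ CARD('n) = ((2 * pi) powr (- 1 / 2)) powr real CARD('n)"
      by (subst powr_realpow) (auto simp: powr_minus powr_half_sqrt divide_simps)
    then show ?thesis by (simp add: powr_powr)
  qed
  finally show ?thesis by (simp add: gauss_density_def)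
qed

text \<open>Link to the definition of \<open>max_modes\<close>: dividing by the total weight and
  renumbering the components by an initial segment of the naturals leave the modes
  unchanged.\<close>

lemma max_modes_ge:
  fixes a :: "'b \<Rightarrow> real ^ 'n::finite"
  assumes "finite J" "J \<noteq> {}" and u: "\<And>k. k \<in> J \<Longrightarrow> u k > 0"
    and a: "\<And>k. k \<in> J \<Longrightarrow> infnorm (a k) \<le> A"
    and M: "finite M" "M \<subseteq> modes (\<lambda>t. \<Sum>k\<in>J. u k * gauss_density (t - a k))"
  shows "max_modes TYPE('n) A \<ge> enat (card M)"
proof -
  let ?f = "\<lambda>t. \<Sum>k\<in>J. u k * gauss_density (t - a k)"
  define W where "W = sum u J"
  have W: "W > 0" unfolding W_def using assms by (intro sum_pos) auto
  obtain b where b: "bij_betw b {..<card J} J"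
    using ex_bij_betw_nat_finite[OF \<open>finite J\<close>] by (auto simp: atLeast0LessThan)
  define p where "p = (\<lambda>k. u (b k) / W)"
  let ?g = "gauss_mixture (card J) p (a \<circ> b)"
  have g: "?g t = ?f t / W" for t
    unfolding gauss_mixture_def p_def
    by (subst sum.reindex_bij_betw[OF b, symmetric]) (simp add: sum_divide_distrib)
  have bJ: "b k \<in> J" if "k < card J" for k using b that by (auto simp: bij_betw_def)
  have "(\<Sum>k<card J. p k) = W / W"
    unfolding p_def sum_divide_distrib[symmetric] sum.reindex_bij_betw[OF b] W_def ..
  then have "(\<Sum>k<card J. p k) = 1" using W by simp
  moreover have "card J \<ge> 1" using assms(1,2) by (simp add: Suc_le_eq card_gt_0_iff)
  ultimately have mem: "num_modes ?g \<le> max_modes TYPE('n) A"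
    unfolding max_modes_def using bJ u a W
    by (intro Sup_upper CollectI exI[of _ "card J"] exI[of _ p] exI[of _ "a \<circ> b"]) (auto simp: p_def)
  have "modes ?g = modes ?f"
    using W by (simp add: modes_def g divide_le_cancel)
  \<comment> \<open>If the mode set is infinite, \<open>num_modes\<close> is infinite and the bound
    is trivial.\<close>
  then have "enat (card M) \<le> num_modes ?g"
    using M by (auto simp: num_modes_def intro: card_mono)
  with mem show ?thesis by (rule order_trans[rotated])
qed

text \<open>Continuity of the finitely many projections gives one neighbourhood where all factor
  inequalities hold; nonnegativity allows multiplying them.\<close>

lemma modes_prod:
  fixes h :: "real \<Rightarrow> real" and t :: "real ^ 'n::finite"
  assumes h: "\<And>s. h s \<ge> 0" and t: "\<And>i. t $ i \<in> modes h"
  shows "t \<in> modes (\<lambda>s. \<Prod>i\<in>UNIV. h (s $ i))"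
proof -
  have "\<forall>\<^sub>F s in nhds t. h (s $ i) \<le> h (t $ i)" for i
  proof -
    have "((\<lambda>s. s $ i) \<longlongrightarrow> t $ i) (nhds t)" by (intro tendsto_vec_nth filterlim_ident)
    then show ?thesis
      using t[of i] unfolding modes_def filterlim_iff by blast
  qed
  then have "\<forall>\<^sub>F s in nhds t. \<forall>i. h (s $ i) \<le> h (t $ i)"
    by (rule eventually_all_finite)
  then have "\<forall>\<^sub>F s in nhds t. (\<Prod>i\<in>UNIV. h (s $ i)) \<le> (\<Prod>i\<in>UNIV. h (t $ i))"
    by eventually_elim (auto intro!: prod_mono h)
  then show ?thesis by (simp add: modes_def)
qed

lemma card_vec_all_in:
  assumes "finite M"
  shows "finite {t :: 'a ^ 'n::finite. \<forall>i. t $ i \<in> M}"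
    and "card {t :: 'a ^ 'n::finite. \<forall>i. t $ i \<in> M} = card M ^ CARD('n)"
proof -
  have b: "bij_betw vec_lambda (PiE (UNIV :: 'n set) (\<lambda>_. M)) {t :: 'a ^ 'n. \<forall>i. t $ i \<in> M}"
    by (rule bij_betwI[where g = vec_nth]) (auto simp: PiE_def)
  show "finite {t :: 'a ^ 'n. \<forall>i. t $ i \<in> M}"
    using bij_betw_finite[OF b] assms by (simp add: finite_PiE)
  show "card {t :: 'a ^ 'n. \<forall>i. t $ i \<in> M} = card M ^ CARD('n)"
    using bij_betw_same_card[OF b] by (simp add: card_PiE)
qed

theorem proposition3:
  shows "\<exists>c::real. c > 0 \<and>
    (\<forall>A::real. A > 0 \<longrightarrow>
      ereal_of_enat (max_modes TYPE('n::finite) A) \<ge> ereal (c * A ^ (2 * CARD('n))))"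
proof (intro exI[of _ "(1 / 128) ^ CARD('n)"] conjI allI impI)
  fix A :: real
  assume "A > 0"
  then obtain I :: "(real \<times> real set) set" and w x M where I:
    "finite I" "I \<noteq> {}" "\<And>k. k \<in> I \<Longrightarrow> w k > 0" "\<And>k. k \<in> I \<Longrightarrow> \<bar>x k\<bar> \<le> A"
    and M: "finite M" "M \<subseteq> modes (finite_mixture I w x)" "real (card M) \<ge> A\<^sup>2 / 128"
    by (rule line_mixture_many_modes) blast
  define h where "h = finite_mixture I w x"
  \<comment> \<open>Expanding the product of sums indexes the components by functions into
    \<open>I\<close>: weights multiply, and centres are assembled coordinatewise.\<close>
  define J where "J = PiE (UNIV :: 'n set) (\<lambda>_. I)"
  define u where "u = (\<lambda>k. \<Prod>i\<in>(UNIV :: 'n set). w (k i))"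
  define a where "a = (\<lambda>k. (\<chi> i::'n. x (k i)))"
  define N where "N = {t :: real ^ 'n. \<forall>i. t $ i \<in> M}"
  have h0: "h s \<ge> 0" for s
    unfolding h_def finite_mixture_def using I(3) by (intro sum_nonneg) (simp add: less_imp_le)
  have prod: "(\<Prod>i\<in>UNIV. h (t $ i)) = (\<Sum>k\<in>J. u k * gauss_density (t - a k))" for t :: "real ^ 'n"
    unfolding h_def finite_mixture_def J_def
    by (subst prod_sum_PiE) (auto simp: I(1) u_def a_def gauss_density_eq_prod prod.distrib)
  have NM: "N \<subseteq> modes (\<lambda>t. \<Sum>k\<in>J. u k * gauss_density (t - a k))"
    unfolding prod[symmetric] using M(2) h0 by (auto simp: N_def h_def[symmetric] intro!: modes_prod)
  \<comment> \<open>In the maximum norm the coordinate bounds carry over with the same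
    \<open>A\<close>, without a dimensional factor.\<close>
  have a_bound: "infnorm (a k) \<le> A" if "k \<in> J" for k
  proof -
    have "\<bar>x (k i)\<bar> \<le> A" for i using that by (intro I(4)) (auto simp: J_def)
    then show ?thesis unfolding infnorm_cart a_def by (intro cSup_least) auto
  qed
  have u_pos: "u k > 0" if "k \<in> J" for k
    unfolding u_def using that by (intro prod_pos I(3)) (auto simp: J_def)
  have "enat (card N) \<le> max_modes TYPE('n) A"
    by (rule max_modes_ge[OF _ _ u_pos a_bound _ NM])
       (use I(1,2) M(1) in \<open>auto simp: J_def N_def PiE_eq_empty_iff card_vec_all_in
          intro!: finite_PiE\<close>)
  then have "ereal_of_enat (enat (card N)) \<le> ereal_of_enat (max_modes TYPE('n) A)"
    by (simp only: ereal_of_enat_le_iff)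
  \<comment> \<open>Each coordinate contributes a factor A^2/128, which explains the choice of the
    constant.\<close>
  moreover have "(1 / 128) ^ CARD('n) * A ^ (2 * CARD('n)) = (A\<^sup>2 / 128) ^ CARD('n)"
    by (simp add: power_mult power_divide)
  moreover have "(A\<^sup>2 / 128) ^ CARD('n) \<le> real (card M) ^ CARD('n)"
    using M(3) by (intro power_mono) auto
  moreover have "real (card N) = real (card M) ^ CARD('n)"
    unfolding N_def by (simp add: card_vec_all_in M(1))
  ultimately show "ereal_of_enat (max_modes TYPE('n) A) \<ge> ereal ((1 / 128) ^ CARD('n) * A ^ (2 * CARD('n)))"
    by (smt (verit) ereal_less_eq(3) ereal_of_enat_simps(1) order_trans)
qed auto

end
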